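(* Let $W$ be a non-negative, integer-valued random variable with $\mathbb{E}[W]=\lambda>0$, let $W^\star$ have the $W$-size-biased distribution, and let $Z_\lambda\sim\mathrm{Po}(\lambda)$. If $W+1\geq_{st}W^\star$, then $$H(W)\leq H(Z_\lambda).$$
   Context: $\mathrm{Po}(\lambda)$ is the Poisson distribution with mean $\lambda$. $W^\star$ has mass function $\mathbb{P}(W^\star=j)=j\,\mathbb{P}(W=j)/\lambda$, $j\in\{0,1,2,\ldots\}$. $\geq_{st}$ denotes the usual stochastic order. The entropy of a non-negative integer-valued random variable $X$ is $H(X)=-\sum_{i=0}^\infty\mathbb{P}(X=i)\log\mathbb{P}(X=i)$ (natural logarithm, $0\log0=0$). *)

theory Defs
  imports "HOL-Probability.Probability"
begin

text \<open>
  The entropy is taken in \<^typ>\<open>ennreal\<close>, so that a divergent sum has the value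
  infinity. Every summand is non-negative because probabilities are at most 1, hence the
  truncating coercion \<^term>\<open>ennreal\<close> loses nothing; the convention \<open>0 log 0 = 0\<close> is
  automatic. The two lemmas below confirm both points.
\<close>

definition nat_entropy :: "'a measure \<Rightarrow> ('a \<Rightarrow> nat) \<Rightarrow> ennreal" where
  "nat_entropy M X =
     (\<Sum>i. ennreal (- (measure M {\<omega> \<in> space M. X \<omega> = i} *
                       ln (measure M {\<omega> \<in> space M. X \<omega> = i}))))"

lemma (in prob_space) nat_entropy_summand_nonneg:
  "0 \<le> - (prob {\<omega> \<in> space M. X \<omega> = (i :: nat)} * ln (prob {\<omega> \<in> space M. X \<omega> = i}))"
proof (cases "prob {\<omega> \<in> space M. X \<omega> = i} = 0")
  case False
  then have "0 < prob {\<omega> \<in> space M. X \<omega> = i}"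
    by (simp add: zero_less_measure_iff)
  moreover have "ln (prob {\<omega> \<in> space M. X \<omega> = i}) \<le> 0"
    using \<open>0 < _\<close> prob_le_1[of "{\<omega> \<in> space M. X \<omega> = i}"] ln_le_zero_iff by blast
  ultimately show ?thesis
    using mult_nonneg_nonpos[of "prob {\<omega> \<in> space M. X \<omega> = i}"
        "ln (prob {\<omega> \<in> space M. X \<omega> = i})"] by linarith
qed simp

lemma (in prob_space) nat_entropy_eq:
  fixes X :: "'a \<Rightarrow> nat"
  defines "p \<equiv> \<lambda>i. prob {\<omega> \<in> space M. X \<omega> = i}"
  assumes summable: "summable (\<lambda>i. p i * ln (p i))"
  shows "nat_entropy M X = ennreal (- (\<Sum>i. p i * ln (p i)))"
proof -
  have nonneg: "0 \<le> - (p i * ln (p i))" for i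
    unfolding p_def by (rule nat_entropy_summand_nonneg)
  have "nat_entropy M X = (\<Sum>i. ennreal (- (p i * ln (p i))))"
    unfolding nat_entropy_def p_def ..
  also have "\<dots> = ennreal (\<Sum>i. - (p i * ln (p i)))"
    by (rule suminf_ennreal2[OF nonneg summable_minus[OF summable]])
  also have "(\<Sum>i. - (p i * ln (p i))) = - (\<Sum>i. p i * ln (p i))"
    by (rule suminf_minus[OF summable])
  finally show ?thesis .
qed

text \<open>
  \<open>st_ge M X N Y\<close> is the usual stochastic order \<open>X \<ge>\<^sub>s\<^sub>t Y\<close>. Only the two laws matter, so
  \<open>X\<close> and \<open>Y\<close> may live on different probability spaces.
\<close>

definition st_ge ::
  "'a measure \<Rightarrow> ('a \<Rightarrow> real) \<Rightarrow> 'b measure \<Rightarrow> ('b \<Rightarrow> real) \<Rightarrow> bool" where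
  "st_ge M X N Y \<longleftrightarrow>
     (\<forall>t. measure N {\<omega> \<in> space N. t < Y \<omega>} \<le> measure M {\<omega> \<in> space M. t < X \<omega>})"

definition size_biased ::
  "'a measure \<Rightarrow> ('a \<Rightarrow> nat) \<Rightarrow> 'b measure \<Rightarrow> ('b \<Rightarrow> nat) \<Rightarrow> bool" where
  "size_biased M W N Wstar \<longleftrightarrow>
     (\<forall>j. measure N {\<omega> \<in> space N. Wstar \<omega> = j} =
          real j * measure M {\<omega> \<in> space M. W \<omega> = j} / (\<integral>\<omega>. real (W \<omega>) \<partial>M))"

end

theory Submission
  imports Defs
begin

text \<open>
  Write \<open>w\<close> and \<open>z\<close> for the mass functions of \<open>W\<close> and of the Poisson law with mean \<open>\<lambda>\<close>. Since
  \<open>- ln (z i) = \<lambda> - i ln \<lambda> + ln (i!)\<close>, Gibbs' inequality bounds \<open>H(W)\<close> by the cross entropy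
  \<open>\<lambda> - \<lambda> ln \<lambda> + E[ln (W!)]\<close>, and for \<open>W = Z\<close> this bound is exactly \<open>H(Z)\<close>. The means
  being equal, it remains to see that \<open>E[ln (W!)] \<le> E[ln (Z!)]\<close>. The sequence \<open>ln (i!)\<close> is
  convex and vanishes at \<open>0\<close> and \<open>1\<close>, hence it is a non-negative combination of the hinges \<open>(i - k)\<^sup>+\<close>, so it is enough to
  compare the stop-loss transforms \<open>L(k) = E[(W - k)\<^sup>+]\<close>.

  That comparison is where size biasing enters. Tail probabilities and tail means are both
  linear in \<open>L\<close>, so the stochastic domination of \<open>W\<^sup>*\<close> by \<open>W + 1\<close> gives
  \<open>(t + 2) L(t + 1) - (t + 1) L(t + 2) \<le> \<lambda> (L(t) - L(t + 1))\<close>, a second-order difference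
  inequality. The Poisson law, for which \<open>Z\<^sup>*\<close> and \<open>Z + 1\<close> have the same law, gives equality.
  The difference of the two transforms is thus a supersolution that vanishes at \<open>0\<close>
  (equal means) and at infinity, and a supersolution of this kind has no negative minimum
  (\<open>discrete_minimum_principle\<close>).
\<close>

section \<open>Laws on the natural numbers as sequences\<close>

lemma (in prob_space) point_masses_sums_prob:
  fixes X :: "'a \<Rightarrow> nat"
  assumes X: "X \<in> measurable M (count_space UNIV)"
  shows "(\<lambda>j. of_bool (Q j) * prob {\<omega> \<in> space M. X \<omega> = j}) sums prob {\<omega> \<in> space M. Q (X \<omega>)}"
proof -
  define A where "A j = {\<omega> \<in> space M. X \<omega> = j \<and> Q j}" for j
  have meas: "{\<omega> \<in> space M. R (X \<omega>)} \<in> sets M" for R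
    using measurable_sets[OF X, of "{j. R j}"]
    by (simp add: vimage_def Int_def conj_commute)
  have "(\<lambda>j. prob (A j)) sums prob (\<Union>j. A j)"
  proof (rule finite_measure_UNION)
    show "range A \<subseteq> events" using meas[of "\<lambda>x. x = j \<and> Q j" for j] by (auto simp: A_def)
    show "disjoint_family A" by (auto simp: disjoint_family_on_def A_def)
  qed
  moreover have "(\<Union>j. A j) = {\<omega> \<in> space M. Q (X \<omega>)}" by (auto simp: A_def)
  moreover have "prob (A j) = of_bool (Q j) * prob {\<omega> \<in> space M. X \<omega> = j}" for j
    by (cases "Q j") (simp_all add: A_def)
  ultimately show ?thesis by simp
qed

lemma (in prob_space) point_masses_sums_expectation:
  fixes X :: "'a \<Rightarrow> nat"
  assumes X: "X \<in> measurable M (count_space UNIV)"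
    and int: "integrable M (\<lambda>\<omega>. real (X \<omega>))"
  shows "(\<lambda>j. prob {\<omega> \<in> space M. X \<omega> = j} * real j) sums expectation (\<lambda>\<omega>. real (X \<omega>))"
proof -
  let ?A = "\<lambda>j. {\<omega> \<in> space M. X \<omega> = j}"
  have meas [measurable]: "?A j \<in> sets M" for j
    using measurable_sets[OF X, of "{j}"] by (simp add: vimage_def Int_def conj_commute)
  have pointwise: "ennreal (real (X \<omega>)) = (\<Sum>j. ennreal (real j) * indicator (?A j) \<omega>)"
    if "\<omega> \<in> space M" for \<omega>
  proof -
    have "(\<Sum>j. ennreal (real j) * indicator (?A j) \<omega>)
        = (\<Sum>j\<in>{X \<omega>}. ennreal (real j) * indicator (?A j) \<omega>)"
      by (rule suminf_finite) auto
    then show ?thesis using that by simp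
  qed
  have "ennreal (expectation (\<lambda>\<omega>. real (X \<omega>))) = (\<integral>\<^sup>+\<omega>. ennreal (real (X \<omega>)) \<partial>M)"
    using int by (simp add: nn_integral_eq_integral)
  also have "\<dots> = (\<integral>\<^sup>+\<omega>. (\<Sum>j. ennreal (real j) * indicator (?A j) \<omega>) \<partial>M)"
    by (rule nn_integral_cong) (rule pointwise)
  also have "\<dots> = (\<Sum>j. \<integral>\<^sup>+\<omega>. ennreal (real j) * indicator (?A j) \<omega> \<partial>M)"
    by (rule nn_integral_suminf) measurable
  also have "\<dots> = (\<Sum>j. ennreal (prob (?A j) * real j))"
    by (simp add: nn_integral_cmult_indicator emeasure_eq_measure ennreal_mult mult.commute)
  finally have eq: "(\<Sum>j. ennreal (prob (?A j) * real j)) = ennreal (expectation (\<lambda>\<omega>. real (X \<omega>)))" ..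
  have summ: "summable (\<lambda>j. prob (?A j) * real j)"
    by (rule summable_suminf_not_top) (simp_all add: eq)
  have "ennreal (\<Sum>j. prob (?A j) * real j) = ennreal (expectation (\<lambda>\<omega>. real (X \<omega>)))"
    unfolding eq[symmetric] by (rule suminf_ennreal2[symmetric]) (simp_all add: summ)
  then have "(\<Sum>j. prob (?A j) * real j) = expectation (\<lambda>\<omega>. real (X \<omega>))"
    by (subst (asm) ennreal_inj) (simp_all add: suminf_nonneg[OF summ])
  with summ show ?thesis by (simp add: sums_iff)
qed

section \<open>Stop-loss transforms\<close>

definition stop_loss :: "(nat \<Rightarrow> real) \<Rightarrow> nat \<Rightarrow> real" where
  "stop_loss p k = (\<Sum>i. p i * real (i - k))"

lemma summable_stop_loss:
  assumes "\<And>i. 0 \<le> p i" and "summable (\<lambda>i. p i * real i)"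
  shows "summable (\<lambda>i. p i * real (i - k))"
  by (rule summable_comparison_test'[OF assms(2), of 0])
     (simp add: assms(1) mult_left_mono)

lemma stop_loss_tendsto_0:
  assumes nonneg: "\<And>i. 0 \<le> p i" and summ: "summable (\<lambda>i. p i * real i)"
  shows "stop_loss p \<longlonglongrightarrow> 0"
proof (rule tendsto_sandwich)
  let ?tail = "\<lambda>k. (\<Sum>i. p i * real i) - (\<Sum>i<k. p i * real i)"
  show "\<forall>\<^sub>F k in sequentially. 0 \<le> stop_loss p k"
    by (simp add: stop_loss_def suminf_nonneg[OF summable_stop_loss[OF assms]] nonneg)
  have "stop_loss p k \<le> ?tail k" for k
  proof -
    have "stop_loss p k = (\<Sum>i. p (i + k) * real i)"
      unfolding stop_loss_def
      by (subst suminf_split_initial_segment[OF summable_stop_loss[OF assms], of _ k]) simp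
    also have "\<dots> \<le> (\<Sum>i. p (i + k) * real (i + k))"
    proof (rule suminf_le)
      show "summable (\<lambda>i. p (i + k) * real i)"
        using summable_ignore_initial_segment[OF summable_stop_loss[OF assms, of k], of k] by simp
      show "summable (\<lambda>i. p (i + k) * real (i + k))"
        by (rule summable_ignore_initial_segment[OF summ])
    qed (simp add: nonneg mult_left_mono)
    also have "\<dots> = ?tail k"
      by (rule suminf_minus_initial_segment[OF summ])
    finally show ?thesis .
  qed
  then show "\<forall>\<^sub>F k in sequentially. stop_loss p k \<le> ?tail k" by simp
  have "?tail \<longlonglongrightarrow> (\<Sum>i. p i * real i) - (\<Sum>i. p i * real i)"
    by (intro tendsto_diff tendsto_const summable_LIMSEQ summ)
  then show "?tail \<longlonglongrightarrow> 0" by simp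
qed simp

text \<open>
  Two neighbouring hinges determine the tail: \<open>1[t < i]\<close> and \<open>i 1[t < i]\<close> are both linear
  combinations of \<open>(i - t)\<^sup>+\<close> and \<open>(i - t - 1)\<^sup>+\<close>. The next two lemmas sum these identities.
\<close>

lemma stop_loss_upper_tail:
  assumes "\<And>i. 0 \<le> p i" and "summable (\<lambda>i. p i * real i)"
  shows "(\<lambda>i. of_bool (t < i) * p i) sums (stop_loss p t - stop_loss p (Suc t))"
proof -
  have "(\<lambda>i. p i * real (i - t) - p i * real (i - Suc t))
      sums (stop_loss p t - stop_loss p (Suc t))"
    unfolding stop_loss_def by (intro sums_diff summable_sums summable_stop_loss assms)
  moreover have "p i * real (i - t) - p i * real (i - Suc t) = of_bool (t < i) * p i" for i
    by (simp add: of_nat_diff algebra_simps)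
  ultimately show ?thesis by simp
qed

lemma stop_loss_upper_partial_mean:
  assumes "\<And>i. 0 \<le> p i" and "summable (\<lambda>i. p i * real i)"
  shows "(\<lambda>i. of_bool (t < i) * (real i * p i))
    sums (real (Suc t) * stop_loss p t - real t * stop_loss p (Suc t))"
proof -
  have "(\<lambda>i. real (Suc t) * (p i * real (i - t)) - real t * (p i * real (i - Suc t)))
      sums (real (Suc t) * stop_loss p t - real t * stop_loss p (Suc t))"
    unfolding stop_loss_def by (intro sums_diff sums_mult summable_sums summable_stop_loss assms)
  moreover have "real (Suc t) * (p i * real (i - t)) - real t * (p i * real (i - Suc t))
      = of_bool (t < i) * (real i * p i)" for i
    by (simp add: of_nat_diff algebra_simps)
  ultimately show ?thesis by simp
qed

text \<open>
  If \<open>D\<close> took a negative value, it would have a negative minimum, as it tends to \<open>0\<close>. The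
  coefficients on the left add up to one less than the coefficient on the right; replacing
  both neighbours by the minimum itself leaves \<open>0 \<le> D m\<close>.
\<close>

lemma discrete_minimum_principle:
  fixes D :: "nat \<Rightarrow> real"
  assumes lim: "D \<longlonglongrightarrow> 0" and D0: "0 \<le> D 0" and lam: "0 \<le> lam"
    and super: "\<And>t. lam * D t + real (Suc t) * D (Suc (Suc t)) \<le> (lam + real (Suc t) + 1) * D (Suc t)"
  shows "0 \<le> D n"
proof (rule ccontr)
  assume "\<not> 0 \<le> D n"
  then have neg: "D n < 0" by simp
  from order_tendstoD(1)[OF lim neg] obtain K where K: "\<And>i. K \<le> i \<Longrightarrow> D n < D i"
    by (auto simp: eventually_sequentially)
  define m where "m = arg_min_on D {..max n K}"
  have m: "D m \<le> D i" if "i \<le> max n K" for i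
    using arg_min_least[of "{..max n K}" i D] that by (simp add: m_def)
  have min: "D m \<le> D i" for i
  proof (cases "i \<le> max n K")
    case False
    then have "K \<le> i" by simp
    then show ?thesis using m[of n] K[of i] by simp
  qed (rule m)
  have mneg: "D m < 0" using min[of n] neg by simp
  then obtain t where t: "m = Suc t" using D0 by (cases m) auto
  have "(lam + real (Suc t)) * D m \<le> lam * D t + real (Suc t) * D (Suc (Suc t))"
    unfolding distrib_right by (intro add_mono mult_left_mono min lam of_nat_0_le_iff)
  also have "\<dots> \<le> (lam + real (Suc t) + 1) * D m" using super[of t] by (simp add: t)
  finally show False using mneg by (simp add: algebra_simps)
qed

text \<open>
  The hypothesis on \<open>p\<close> is the stochastic domination of the size-biased law of \<open>p\<close> by its
  unit shift, multiplied by the mean to avoid a quotient. The recursion for \<open>q\<close> is the Poisson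
  recursion, under which that domination becomes an equality.
\<close>

theorem size_bias_domination_imp_stop_loss_le:
  assumes p0: "\<And>i. 0 \<le> p i" and pmean: "(\<lambda>i. p i * real i) sums lam"
    and q0: "\<And>i. 0 \<le> q i" and qmean: "(\<lambda>i. q i * real i) sums lam"
    and lam: "0 \<le> lam"
    and dom: "\<And>t. (\<Sum>i. of_bool (Suc t < i) * (real i * p i)) \<le> lam * (\<Sum>i. of_bool (t < i) * p i)"
    and qrec: "\<And>i. real (Suc i) * q (Suc i) = lam * q i"
  shows "stop_loss p k \<le> stop_loss q k"
proof -
  note ps = sums_summable[OF pmean] and qs = sums_summable[OF qmean]
  define D where "D k = stop_loss q k - stop_loss p k" for k
  have "0 \<le> D k"
  proof (rule discrete_minimum_principle[OF _ _ lam])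
    show "D \<longlonglongrightarrow> 0"
      using tendsto_diff[OF stop_loss_tendsto_0[OF q0 qs] stop_loss_tendsto_0[OF p0 ps]]
      by (simp add: D_def[abs_def])
    show "0 \<le> D 0"
      using pmean qmean by (simp add: D_def stop_loss_def sums_iff)
    fix t
    (* Both laws at the threshold Suc t: an inequality for p, the same equation for q. *)
    have p: "real (Suc (Suc t)) * stop_loss p (Suc t) - real (Suc t) * stop_loss p (Suc (Suc t))
        \<le> lam * (stop_loss p t - stop_loss p (Suc t))"
      using dom[of t] sums_unique[OF stop_loss_upper_partial_mean[OF p0 ps, of "Suc t"]]
        sums_unique[OF stop_loss_upper_tail[OF p0 ps, of t]] by simp
    have "(\<lambda>i. of_bool (Suc t < Suc i) * (real (Suc i) * q (Suc i)))
        sums (lam * (stop_loss q t - stop_loss q (Suc t)))"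
      using sums_mult[OF stop_loss_upper_tail[OF q0 qs, of t], of lam]
      by (simp add: qrec mult.left_commute del: of_nat_Suc)
    then have "(\<lambda>i. of_bool (Suc t < i) * (real i * q i))
        sums (lam * (stop_loss q t - stop_loss q (Suc t)))"
      by (subst (asm) sums_Suc_iff) simp
    from sums_unique2[OF this stop_loss_upper_partial_mean[OF q0 qs, of "Suc t"]]
    have q: "real (Suc (Suc t)) * stop_loss q (Suc t) - real (Suc t) * stop_loss q (Suc (Suc t))
        = lam * (stop_loss q t - stop_loss q (Suc t))" by simp
    show "lam * D t + real (Suc t) * D (Suc (Suc t)) \<le> (lam + real (Suc t) + 1) * D (Suc t)"
      using p q by (simp add: D_def algebra_simps)
  qed
  then show ?thesis by (simp add: D_def)
qed

text \<open>
  Stop-loss order passes to every non-negative combination \<open>h\<close> of hinges. The mean of \<open>h\<close>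
  under \<open>p\<close> is not known to be finite in advance, so the interchange of sums is done on the
  truncations of \<open>h\<close> to \<open>n\<close> hinges: these are finite sums, they lie below \<open>h\<close>, and they
  agree with \<open>h\<close> up to \<open>n\<close>, which bounds every partial sum of that mean by the mean of \<open>h\<close>
  under \<open>q\<close>.
\<close>

lemma stop_loss_le_imp_convex_mean_le:
  fixes c :: "nat \<Rightarrow> real"
  defines "h \<equiv> \<lambda>i. \<Sum>k<i. c k * real (i - k)"
  assumes p0: "\<And>i. 0 \<le> p i" and ps: "summable (\<lambda>i. p i * real i)"
    and q0: "\<And>i. 0 \<le> q i" and qs: "summable (\<lambda>i. q i * real i)"
    and le: "\<And>k. stop_loss p k \<le> stop_loss q k"
    and c0: "\<And>k. 0 \<le> c k" and hs: "summable (\<lambda>i. q i * h i)"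
  shows "summable (\<lambda>i. p i * h i)" and "(\<Sum>i. p i * h i) \<le> (\<Sum>i. q i * h i)"
proof -
  define hn where "hn n i = (\<Sum>k<n. c k * real (i - k))" for n i
  have hn_eq: "hn n i = h i" if "i \<le> n" for n i
    unfolding hn_def h_def by (rule sum.mono_neutral_right) (use that in auto)
  have hn_le: "hn n i \<le> h i" for n i
    unfolding hn_eq[of i "max n i", simplified, symmetric] hn_def
    by (rule sum_mono2) (auto simp: c0)
  have hn0: "0 \<le> hn n i" for n i by (simp add: hn_def sum_nonneg c0)
  have h0: "0 \<le> h i" for i using hn0[of i i] hn_eq[of i i] by simp
  have hn_sums: "(\<lambda>i. r i * hn n i) sums (\<Sum>k<n. c k * stop_loss r k)"
    if "\<And>i. 0 \<le> r i" "summable (\<lambda>i. r i * real i)" for r n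
  proof -
    have "(\<lambda>i. \<Sum>k<n. c k * (r i * real (i - k))) sums (\<Sum>k<n. c k * stop_loss r k)"
      unfolding stop_loss_def
      by (intro sums_sum sums_mult summable_sums summable_stop_loss that)
    then show ?thesis by (simp add: hn_def sum_distrib_left mult.left_commute)
  qed
  have bound: "(\<Sum>i<n. p i * h i) \<le> (\<Sum>i. q i * h i)" for n
  proof -
    have "(\<Sum>i<n. p i * h i) = (\<Sum>i<n. p i * hn n i)"
      by (intro sum.cong) (auto simp: hn_eq)
    also have "\<dots> \<le> (\<Sum>i. p i * hn n i)"
      by (rule sum_le_suminf[OF sums_summable[OF hn_sums[OF p0 ps]]]) (auto simp: p0 hn0)
    also have "\<dots> \<le> (\<Sum>i. q i * hn n i)"
      unfolding sums_unique[OF hn_sums[OF p0 ps], symmetric]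
        sums_unique[OF hn_sums[OF q0 qs], symmetric]
      by (intro sum_mono mult_left_mono le c0)
    also have "\<dots> \<le> (\<Sum>i. q i * h i)"
      by (rule suminf_le[OF _ sums_summable[OF hn_sums[OF q0 qs]] hs])
         (simp add: mult_left_mono hn_le q0)
    finally show ?thesis .
  qed
  show ph: "summable (\<lambda>i. p i * h i)"
    by (rule bounded_imp_summable[of _ "\<Sum>i. q i * h i"])
       (use bound[of "Suc n" for n] in \<open>simp_all add: p0 h0 lessThan_Suc_atMost\<close>)
  show "(\<Sum>i. p i * h i) \<le> (\<Sum>i. q i * h i)"
    by (rule suminf_le_const[OF ph bound])
qed

text \<open>
  The coefficients are the second differences of \<open>ln (i!)\<close>. At \<open>k = 0\<close> the coefficient is
  \<open>0\<close>, by the default value \<open>ln 0 = 0\<close>, as it must be because \<open>ln (0!) = ln (1!)\<close>.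
\<close>

lemma ln_fact_as_hinge_sum:
  "ln (fact i :: real) = (\<Sum>k<i. (ln (real (Suc k)) - ln (real k)) * real (i - k))"
proof (induction i)
  case (Suc i)
  let ?c = "\<lambda>k. ln (real (Suc k)) - ln (real k)"
  have "(\<Sum>k<Suc i. ?c k * real (Suc i - k)) = (\<Sum>k<Suc i. ?c k * real (i - k) + ?c k)"
    by (intro sum.cong) (auto simp: of_nat_diff algebra_simps)
  also have "\<dots> = (\<Sum>k<i. ?c k * real (i - k)) + (\<Sum>k<Suc i. ?c k)"
    by (simp add: sum.distrib)
  also have "(\<Sum>k<Suc i. ?c k) = ln (real (Suc i))"
    by (subst sum_lessThan_telescope) simp
  also have "(\<Sum>k<i. ?c k * real (i - k)) + ln (real (Suc i)) = ln (fact (Suc i))"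
    unfolding Suc.IH[symmetric] by (simp add: ln_mult del: of_nat_Suc)
  finally show ?case ..
qed simp

section \<open>The Poisson law\<close>

lemma poisson_pmf_Suc:
  assumes "0 < lam"
  shows "real (Suc i) * pmf (poisson_pmf lam) (Suc i) = lam * pmf (poisson_pmf lam) i"
  using assms by (simp add: field_simps del: of_nat_Suc)

lemma poisson_pmf_sums_1:
  assumes "0 < lam"
  shows "pmf (poisson_pmf lam) sums 1"
proof -
  have "(\<lambda>i. lam ^ i /\<^sub>R fact i * exp (- lam)) sums (exp lam * exp (- lam))"
    by (intro sums_mult2 exp_converges)
  moreover have "lam ^ i /\<^sub>R fact i * exp (- lam) = pmf (poisson_pmf lam) i" for i
    using assms by (simp add: divide_inverse mult.commute)
  ultimately show ?thesis by (simp add: mult_exp_exp del: pmf_poisson)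
qed

lemma poisson_pmf_mean_sums:
  assumes "0 < lam"
  shows "(\<lambda>i. pmf (poisson_pmf lam) i * real i) sums lam"
proof -
  have "(\<lambda>i. pmf (poisson_pmf lam) (Suc i) * real (Suc i)) sums lam"
    using sums_mult[OF poisson_pmf_sums_1[OF assms], of lam] poisson_pmf_Suc[OF assms]
    by (simp add: mult.commute del: pmf_poisson of_nat_Suc)
  then show ?thesis by (subst (asm) sums_Suc_iff) simp
qed

text \<open>
  This bound is chosen because the Poisson recursion evaluates factorial moments: one shift
  of the index turns \<open>i (i - 1)\<close> under the Poisson law into a multiple of its mean.
\<close>

lemma ln_fact_le: "ln (fact i :: real) \<le> real i * (real i - 1)"
proof (induction i)
  case (Suc i)
  have "ln (fact (Suc i) :: real) = ln (real (Suc i)) + ln (fact i)"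
    by (simp add: ln_mult del: of_nat_Suc)
  also have "\<dots> \<le> real i + real i * (real i - 1)"
    using Suc ln_le_minus_one[of "real (Suc i)"] by simp
  also have "\<dots> \<le> real (Suc i) * (real (Suc i) - 1)" by (simp add: algebra_simps)
  finally show ?case .
qed simp

lemma poisson_summable_ln_fact:
  assumes "0 < lam"
  shows "summable (\<lambda>i. pmf (poisson_pmf lam) i * ln (fact i))"
proof (rule summable_comparison_test')
  have "summable (\<lambda>i. lam * (pmf (poisson_pmf lam) i * real i))"
    by (intro summable_mult sums_summable[OF poisson_pmf_mean_sums[OF assms]])
  also have "(\<lambda>i. lam * (pmf (poisson_pmf lam) i * real i))
      = (\<lambda>i. pmf (poisson_pmf lam) (Suc i) * (real (Suc i) * (real (Suc i) - 1)))"
    using poisson_pmf_Suc[OF assms] by (auto simp: fun_eq_iff mult_ac simp del: pmf_poisson)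
  finally show "summable (\<lambda>i. pmf (poisson_pmf lam) i * (real i * (real i - 1)))"
    by (subst (asm) summable_Suc_iff)
  show "norm (pmf (poisson_pmf lam) i * ln (fact i))
      \<le> pmf (poisson_pmf lam) i * (real i * (real i - 1))" if "0 \<le> i" for i
    using ln_fact_le[of i] by (simp add: mult_left_mono ln_ge_zero del: pmf_poisson)
qed

text \<open>
  The logarithm of the Poisson mass function is affine up to \<open>ln (i!)\<close>, so among laws with
  mean \<open>\<lambda>\<close> the cross entropy against the Poisson law depends only on the mean of \<open>ln (i!)\<close>.
  Taking \<open>p\<close> itself Poisson yields the Poisson entropy.
\<close>

lemma poisson_cross_entropy_sums:
  assumes lam: "0 < lam" and mass: "p sums 1" and mean: "(\<lambda>i. p i * real i) sums lam"
    and fs: "summable (\<lambda>i. p i * ln (fact i))"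
  shows "(\<lambda>i. - (p i * ln (pmf (poisson_pmf lam) i)))
    sums (lam - lam * ln lam + (\<Sum>i. p i * ln (fact i)))"
proof -
  have "(\<lambda>i. p i * lam - p i * real i * ln lam + p i * ln (fact i))
      sums (1 * lam - lam * ln lam + (\<Sum>i. p i * ln (fact i)))"
    by (intro sums_add sums_diff sums_mult2 mass mean summable_sums fs)
  moreover have "p i * lam - p i * real i * ln lam + p i * ln (fact i)
      = - (p i * ln (pmf (poisson_pmf lam) i))" for i
    using lam by (simp add: ln_mult ln_div ln_realpow algebra_simps)
  ultimately show ?thesis by simp
qed

section \<open>The entropy bound\<close>

text \<open>
  The correction \<open>y - x\<close> makes Gibbs' inequality hold term by term and sums to zero over two
  probability laws. A termwise bound also shows that the entropy series converges.
\<close>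

lemma gibbs_inequality_pointwise:
  fixes x y :: real
  assumes "0 \<le> x" "0 < y"
  shows "- (x * ln x) \<le> - (x * ln y) + y - x"
proof (cases "x = 0")
  case False
  then have x: "0 < x" using assms by simp
  have "x * ln (y / x) \<le> x * (y / x - 1)"
    by (intro mult_left_mono ln_le_minus_one) (use x assms in auto)
  then show ?thesis using x assms by (simp add: ln_div algebra_simps)
qed (use assms in simp)

theorem corollary2p3:
  fixes M :: "'a measure" and N :: "'b measure" and P :: "'c measure"
    and W :: "'a \<Rightarrow> nat" and Wstar :: "'b \<Rightarrow> nat" and Z :: "'c \<Rightarrow> nat"
    and lam :: real
  assumes "prob_space M" and "W \<in> measurable M (count_space UNIV)"
    and "integrable M (\<lambda>\<omega>. real (W \<omega>))"
    and "(\<integral>\<omega>. real (W \<omega>) \<partial>M) = lam" and "lam > 0"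
    and "prob_space N" and "Wstar \<in> measurable N (count_space UNIV)"
    and "size_biased M W N Wstar"
    and "prob_space P" and "Z \<in> measurable P (count_space UNIV)"
    and "distr P (count_space UNIV) Z = measure_pmf (poisson_pmf lam)"
    and "st_ge M (\<lambda>\<omega>. real (W \<omega> + 1)) N (\<lambda>\<omega>. real (Wstar \<omega>))"
  shows "nat_entropy M W \<le> nat_entropy P Z"
proof -
  interpret M: prob_space M by fact
  interpret N: prob_space N by fact
  note lam = \<open>lam > 0\<close>
  define w where "w i = measure M {\<omega> \<in> space M. W \<omega> = i}" for i
  define z where "z = pmf (poisson_pmf lam)"
  have w0: "0 \<le> w i" and z0: "0 \<le> z i" for i by (simp_all add: w_def z_def del: pmf_poisson)
  have zpos: "0 < z i" for i using lam by (simp add: z_def)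
  have w1: "w sums 1"
    using M.point_masses_sums_prob[OF assms(2), of "\<lambda>_. True"]
    by (simp add: w_def[abs_def] M.prob_space)
  have wmean: "(\<lambda>i. w i * real i) sums lam"
    using M.point_masses_sums_expectation[OF assms(2,3)] assms(4) by (simp add: w_def)
  note z1 = poisson_pmf_sums_1[OF lam, folded z_def]
  note zmean = poisson_pmf_mean_sums[OF lam, folded z_def]
  note zfact = poisson_summable_ln_fact[OF lam, folded z_def]
  have dom: "(\<Sum>i. of_bool (Suc t < i) * (real i * w i)) \<le> lam * (\<Sum>i. of_bool (t < i) * w i)" for t
  proof -
    have "(\<lambda>j. of_bool (Suc t < j) * (real j * w j / lam))
        sums measure N {\<omega> \<in> space N. Suc t < Wstar \<omega>}"
      using N.point_masses_sums_prob[OF assms(7), of "\<lambda>j. Suc t < j"] assms(4,8)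
      by (simp add: size_biased_def w_def)
    from sums_unique[OF sums_mult[OF this, of lam]]
    have "(\<Sum>i. of_bool (Suc t < i) * (real i * w i))
        = lam * measure N {\<omega> \<in> space N. Suc t < Wstar \<omega>}"
      using lam by (simp add: mult.left_commute)
    also have "\<dots> \<le> lam * measure M {\<omega> \<in> space M. t < W \<omega>}"
      using assms(12)[unfolded st_ge_def, rule_format, of "real (Suc t)"] lam
      by (intro mult_left_mono) (simp_all only: of_nat_less_iff Suc_eq_plus1 add_less_cancel_right less_imp_le)
    also have "measure M {\<omega> \<in> space M. t < W \<omega>} = (\<Sum>i. of_bool (t < i) * w i)"
      using sums_unique[OF M.point_masses_sums_prob[OF assms(2), of "\<lambda>j. t < j"]] by (simp add: w_def)
    finally show ?thesis .
  qed
  have le: "stop_loss w k \<le> stop_loss z k" for k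
    using size_bias_domination_imp_stop_loss_le[OF w0 wmean z0 zmean less_imp_le[OF lam] dom]
      poisson_pmf_Suc[OF lam] by (simp add: z_def del: pmf_poisson)
  have c0: "0 \<le> ln (real (Suc k)) - ln (real k)" for k
    by (cases k) simp_all
  note cmp = stop_loss_le_imp_convex_mean_le[where c = "\<lambda>k. ln (real (Suc k)) - ln (real k)", OF w0 sums_summable[OF wmean] z0
      sums_summable[OF zmean] le c0, folded ln_fact_as_hinge_sum, OF zfact]
  note wcross = poisson_cross_entropy_sums[OF lam w1 wmean cmp(1), folded z_def]
  note zcross = poisson_cross_entropy_sums[OF lam z1 zmean zfact, folded z_def]
  define b where "b i = - (w i * ln (z i)) + z i - w i" for i
  have b: "- (w i * ln (w i)) \<le> b i" for i
    unfolding b_def by (rule gibbs_inequality_pointwise[OF w0 zpos])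
  have b0: "0 \<le> b i" for i
    using b[of i] M.nat_entropy_summand_nonneg[of W i] by (simp add: w_def)
  have bsums: "b sums (lam - lam * ln lam + (\<Sum>i. w i * ln (fact i)))"
    using sums_diff[OF sums_add[OF wcross z1] w1] by (simp add: b_def[abs_def])
  have Zz: "measure P {\<omega> \<in> space P. Z \<omega> = i} = z i" for i
  proof -
    have "z i = measure (distr P (count_space UNIV) Z) {i}"
      by (simp add: assms(11) z_def pmf.rep_eq del: pmf_poisson)
    also have "\<dots> = measure P {\<omega> \<in> space P. Z \<omega> = i}"
      by (subst measure_distr[OF assms(10)]) (auto intro!: arg_cong[of _ _ "measure P"])
    finally show ?thesis ..
  qed
  have "nat_entropy M W \<le> (\<Sum>i. ennreal (b i))"
    unfolding nat_entropy_def w_def[symmetric] by (intro suminf_le ennreal_leI b) auto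
  also have "\<dots> = ennreal (lam - lam * ln lam + (\<Sum>i. w i * ln (fact i)))"
    using suminf_ennreal2[OF b0 sums_summable[OF bsums]] sums_unique[OF bsums] by simp
  also have "\<dots> \<le> ennreal (lam - lam * ln lam + (\<Sum>i. z i * ln (fact i)))"
    by (intro ennreal_leI add_left_mono cmp(2))
  also have "\<dots> = (\<Sum>i. ennreal (- (z i * ln (z i))))"
  proof -
    have "0 \<le> - (z i * ln (z i))" for i
      using mult_nonneg_nonpos[OF z0[of i], of "ln (z i)"] ln_le_zero_iff[OF zpos[of i]]
      by (simp add: z_def pmf_le_1 del: pmf_poisson)
    from suminf_ennreal2[OF this sums_summable[OF zcross]] sums_unique[OF zcross]
    show ?thesis by simp
  qed
  also have "\<dots> = nat_entropy P Z" by (simp add: nat_entropy_def Zz)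
  finally show ?thesis .
qed

end
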